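(* Let $f:\mathbb{R}^n\to\mathbb{R}$ be continuously differentiable, strongly convex with parameter $\rho>0$ and strongly smooth with parameter $\ell$. Let $A\in\mathbb{R}^{m\times n}$ satisfy $a_{\min}I_m\preceq AA^\top\preceq a_{\max}I_m$ for some $a_{\min},a_{\max}>0$, and let $b\in\mathbb{R}^m$. Then the continuous-time primal-dual dynamics $$\dot x=-\nabla f(x)-A^\top\lambda,\qquad \dot\lambda=Ax-b$$ on $\mathbb{R}^n\times\mathbb{R}^m$ are strongly infinitesimally contracting with respect to $\|\cdot\|_P$ with rate $c>0$, where $$P=\begin{bmatrix}I_n&\alpha A^\top\\ \alpha A&I_m\end{bmatrix}\succ0,\qquad \alpha=\frac12\min\Big\{\frac1\ell,\frac{\rho}{a_{\max}}\Big\},\qquad c=\frac12\alpha a_{\min}=\frac14\min\Big\{\frac{a_{\min}}{\ell},\frac{a_{\min}}{a_{\max}}\rho\Big\}.$$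
   Context: $f$ is strongly convex with parameter $\rho$ if $x\mapsto f(x)-\frac\rho2\|x\|_2^2$ is convex, and strongly smooth with parameter $\ell$ if $\nabla f$ is Lipschitz on $(\mathbb{R}^n,\|\cdot\|_2)$ with constant $\ell$. For symmetric matrices, $X\preceq Y$ means $Y-X$ is positive semidefinite. For symmetric positive definite $P$, $\|z\|_P=\sqrt{z^\top Pz}$. Dynamics $\dot z=G(z)$ with $G$ continuous are strongly infinitesimally contracting with respect to $\|\cdot\|_P$ with rate $c>0$ if $(G(z_1)-G(z_2))^\top P(z_1-z_2)\le -c\|z_1-z_2\|_P^2$ for all $z_1,z_2$. *)

theory Defs
  imports "HOL-Analysis.Analysis"
begin

definition gradient :: "('a::real_inner \<Rightarrow> real) \<Rightarrow> 'a \<Rightarrow> 'a" where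
  "gradient f x = (THE D. GDERIV f x :> D)"

text \<open>The gradient is only meaningful where \<open>f\<close> is differentiable, which is the first conjunct of
  continuous differentiability below.\<close>

definition continuously_differentiable :: "('a::euclidean_space \<Rightarrow> real) \<Rightarrow> bool" where
  "continuously_differentiable f \<longleftrightarrow>
     (\<forall>x. f differentiable (at x)) \<and> continuous_on UNIV (gradient f)"

definition strongly_convex :: "real \<Rightarrow> ('a::euclidean_space \<Rightarrow> real) \<Rightarrow> bool" where
  "strongly_convex \<rho> f \<longleftrightarrow> convex_on UNIV (\<lambda>x. f x - \<rho> / 2 * (norm x)\<^sup>2)"

definition strongly_smooth :: "real \<Rightarrow> ('a::euclidean_space \<Rightarrow> real) \<Rightarrow> bool" where
  "strongly_smooth l f \<longleftrightarrow> l-lipschitz_on UNIV (gradient f)"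

definition pos_semidef :: "real^'k^'k \<Rightarrow> bool" where
  "pos_semidef M \<longleftrightarrow> transpose M = M \<and> (\<forall>v. 0 \<le> v \<bullet> (M *v v))"

definition pos_def :: "real^'k^'k \<Rightarrow> bool" where
  "pos_def M \<longleftrightarrow> transpose M = M \<and> (\<forall>v. v \<noteq> 0 \<longrightarrow> 0 < v \<bullet> (M *v v))"

definition loewner_le :: "real^'k^'k \<Rightarrow> real^'k^'k \<Rightarrow> bool"  (infix "\<preceq>" 50) where
  "X \<preceq> Y \<longleftrightarrow> pos_semidef (Y - X)"

definition weighted_norm :: "real^'k^'k \<Rightarrow> real^'k \<Rightarrow> real" where
  "weighted_norm P z = sqrt (z \<bullet> (P *v z))"

definition strongly_inf_contracting ::
    "real^'k^'k \<Rightarrow> real \<Rightarrow> (real^'k \<Rightarrow> real^'k) \<Rightarrow> bool" where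
  "strongly_inf_contracting P c G \<longleftrightarrow>
     pos_def P \<and> c > 0 \<and> continuous_on UNIV G \<and>
     (\<forall>z1 z2. (G z1 - G z2) \<bullet> (P *v (z1 - z2)) \<le> - c * (weighted_norm P (z1 - z2))\<^sup>2)"

text \<open>The space of pairs of an \<open>n\<close>-vector and an \<open>m\<close>-vector is represented by vectors indexed
  by the disjoint sum of the two index types, so that block matrices are ordinary square matrices.\<close>

definition join_vec :: "real^'n \<Rightarrow> real^'m \<Rightarrow> real^('n + 'm)" where
  "join_vec x y = (\<chi> k. case k of Inl i \<Rightarrow> x $ i | Inr j \<Rightarrow> y $ j)"

definition left_part :: "real^('n::finite + 'm::finite) \<Rightarrow> real^'n" where
  "left_part z = (\<chi> i. z $ Inl i)"

definition right_part :: "real^('n::finite + 'm::finite) \<Rightarrow> real^'m" where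
  "right_part z = (\<chi> j. z $ Inr j)"

definition block_matrix ::
    "real^'n^'n \<Rightarrow> real^'m^'n \<Rightarrow> real^'n^'m \<Rightarrow> real^'m^'m \<Rightarrow> real^('n::finite + 'm::finite)^('n + 'm)" where
  "block_matrix A B C D =
     (\<chi> k. case k of Inl i \<Rightarrow> join_vec (A $ i) (B $ i) | Inr j \<Rightarrow> join_vec (C $ j) (D $ j))"

text \<open>Right-hand side of the dynamics
  \<open>x' = - gradient f x - A\<^sup>T \<lambda>\<close>, \<open>\<lambda>' = A x - b\<close>, with \<open>z = (x, \<lambda>)\<close>.\<close>

definition primal_dual_dynamics ::
    "(real^'n \<Rightarrow> real) \<Rightarrow> real^'n^'m \<Rightarrow> real^'m \<Rightarrow> real^('n + 'm) \<Rightarrow> real^('n + 'm)" where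
  "primal_dual_dynamics f A b z =
     join_vec (- gradient f (left_part z) - transpose A *v right_part z)
              (A *v left_part z - b)"

end

theory Submission
  imports Defs
begin

text \<open>For two states, let \<open>x\<close> and \<open>y\<close> be the differences of the primal and the dual
  parts, \<open>g\<close> the difference of the gradients and \<open>w = transpose A *v y\<close>. In the
  \<open>P\<close>-inner product the skew coupling between \<open>x\<close> and \<open>y\<close> cancels, and
  contraction at rate \<open>c\<close> becomes
  \<open>g \<bullet> x + \<alpha> (g \<bullet> w) + \<alpha> |w|^2 - \<alpha> |A x|^2
     \<ge> c (|x|^2 + |y|^2 + 2 \<alpha> (x \<bullet> w))\<close>.
  The off-diagonal blocks of \<open>P\<close> thus provide dissipation in the dual direction, through
  \<open>\<alpha> |w|^2 \<ge> \<alpha> a_min |y|^2 = 2 c |y|^2\<close>. Half of it pays for \<open>c |y|^2\<close>, and the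
  other half absorbs both mixed terms at once: they combine to \<open>\<alpha> (h \<bullet> w)\<close> with
  \<open>h = g - 2 c x\<close>, so that completing the square costs only \<open>\<alpha>/2 |h|^2\<close>.

  Bounding \<open>|g|\<close> by \<open>l |x|\<close> would be too lossy here. What makes the step size
  \<open>\<alpha> \<le> 1 / (2 l)\<close> sufficient is that the gradient of a convex function with
  \<open>l\<close>-Lipschitz gradient is cocoercive, \<open>|g|^2 \<le> l (g \<bullet> x)\<close>
  (\<open>convex_gradient_cocoercive\<close>); it yields \<open>\<alpha>/2 |h|^2 \<le> (g \<bullet> x) / 4\<close>.
  The remaining \<open>3/4 (g \<bullet> x) \<ge> 3/4 \<rho> |x|^2\<close> covers
  \<open>\<alpha> |A x|^2 \<le> \<alpha> a_max |x|^2 \<le> \<rho>/2 |x|^2\<close> and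
  \<open>c |x|^2 \<le> \<rho>/4 |x|^2\<close>, the last because \<open>a_min \<le> a_max\<close>. This is
  \<open>contraction_estimate\<close>. The metric is positive definite because
  \<open>\<alpha>\<^sup>2 a_max \<le> \<alpha> \<rho> / 2 \<le> 1 / 4\<close>, using \<open>\<rho> \<le> l\<close>
  (\<open>saddle_metric_pos_def\<close>).\<close>

section \<open>Gradients of convex functions\<close>

lemma GDERIV_gradient:
  fixes f :: "'a::euclidean_space \<Rightarrow> real"
  assumes "f differentiable (at x)"
  shows "GDERIV f x :> gradient f x"
proof -
  obtain f' where f': "(f has_derivative f') (at x)"
    using assms by (auto simp: differentiable_def)
  have "linear f'"
    using f' by (rule has_derivative_linear)
  then have "f' = (\<lambda>h. h \<bullet> adjoint f' 1)"
    by (auto simp: adjoint_works)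
  then have D: "GDERIV f x :> adjoint f' 1"
    unfolding gderiv_def using f' by metis
  show ?thesis
    unfolding gradient_def
  proof (rule theI[of "\<lambda>D. GDERIV f x :> D", OF D])
    fix E assume "GDERIV f x :> E"
    then have "(\<lambda>h. h \<bullet> E) = (\<lambda>h. h \<bullet> adjoint f' 1)"
      using D unfolding gderiv_def by (rule has_derivative_unique)
    then show "E = adjoint f' 1"
      by (simp add: fun_eq_iff vector_eq_ldot)
  qed
qed

lemma DERIV_along_line:
  assumes "\<And>z. GDERIV f z :> g z"
  shows "((\<lambda>t. f (x + t *\<^sub>R d)) has_real_derivative g (x + t *\<^sub>R d) \<bullet> d) (at t)"
proof -
  have "((\<lambda>t. f (x + t *\<^sub>R d)) has_derivative (\<lambda>h. (h *\<^sub>R d) \<bullet> g (x + t *\<^sub>R d))) (at t)"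
  proof (rule has_derivative_compose[of "\<lambda>t. x + t *\<^sub>R d"])
    show "((\<lambda>t. x + t *\<^sub>R d) has_derivative (\<lambda>h. h *\<^sub>R d)) (at t)"
      by (auto intro!: derivative_eq_intros)
    show "(f has_derivative (\<lambda>v. v \<bullet> g (x + t *\<^sub>R d))) (at (x + t *\<^sub>R d))"
      using assms unfolding gderiv_def .
  qed
  then show ?thesis
    by (simp add: has_field_derivative_def inner_commute mult_commute_abs)
qed

text \<open>Restriction to the line through the two points reduces the claim to the tangent inequality
  for convex functions of one real variable.\<close>

lemma convex_above_tangent:
  fixes f :: "'a::real_inner \<Rightarrow> real"
  assumes convex: "convex_on UNIV f" and deriv: "\<And>z. GDERIV f z :> g z"
  shows "f x + g x \<bullet> (y - x) \<le> f y"
proof -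
  define h where "h t = f (x + t *\<^sub>R (y - x))" for t
  have "convex_on UNIV h"
  proof (rule convex_onI)
    fix t s r :: real
    assume t: "0 < t" "t < 1"
    have "x + ((1 - t) * s + t * r) *\<^sub>R (y - x)
        = (1 - t) *\<^sub>R (x + s *\<^sub>R (y - x)) + t *\<^sub>R (x + r *\<^sub>R (y - x))"
      by (simp add: algebra_simps)
    then show "h ((1 - t) *\<^sub>R s + t *\<^sub>R r) \<le> (1 - t) * h s + t * h r"
      using convex_onD[OF convex, of t "x + s *\<^sub>R (y - x)" "x + r *\<^sub>R (y - x)"] t
      by (simp add: h_def)
  qed auto
  moreover have "(h has_real_derivative g x \<bullet> (y - x)) (at 0)"
    using DERIV_along_line[OF deriv, where x=x and d="y - x" and t=0] unfolding h_def by simp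
  ultimately have "h 1 - h 0 \<ge> (g x \<bullet> (y - x)) * (1 - 0)"
    by (intro convex_on_imp_above_tangent[where A=UNIV]) auto
  then show ?thesis
    by (simp add: h_def)
qed

text \<open>The tangent inequality for the convex function \<open>f x - \<rho> / 2 * (norm x)\<^sup>2\<close>, with
  the quadratic part moved back to the side of \<open>f\<close>.\<close>

lemma strongly_convex_above_tangent:
  fixes f :: "'a::euclidean_space \<Rightarrow> real"
  assumes "strongly_convex \<rho> f" and deriv: "\<And>z. GDERIV f z :> g z"
  shows "f x + g x \<bullet> (y - x) + \<rho> / 2 * (norm (y - x))\<^sup>2 \<le> f y"
proof -
  define q where "q z = f z - \<rho> / 2 * (norm z)\<^sup>2" for z
  have "GDERIV q z :> g z - \<rho> *\<^sub>R z" for z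
    using deriv[of z] unfolding gderiv_def q_def power2_norm_eq_inner
    by (auto intro!: derivative_eq_intros simp: algebra_simps inner_commute)
  moreover have "convex_on UNIV q"
    using assms unfolding strongly_convex_def q_def by blast
  ultimately have "q x + (g x - \<rho> *\<^sub>R x) \<bullet> (y - x) \<le> q y"
    by (rule convex_above_tangent[rotated])
  then show ?thesis
    unfolding q_def power2_norm_eq_inner
    by (simp add: algebra_simps inner_commute)
qed

lemma strongly_convex_gradient_monotone:
  fixes f :: "'a::euclidean_space \<Rightarrow> real"
  assumes "strongly_convex \<rho> f" and "\<And>z. GDERIV f z :> g z"
  shows "\<rho> * (norm (x - y))\<^sup>2 \<le> (g x - g y) \<bullet> (x - y)"
  using strongly_convex_above_tangent[OF assms, of x y]
    strongly_convex_above_tangent[OF assms, of y x]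
  by (simp add: algebra_simps norm_minus_commute)

lemma strongly_convex_imp_convex:
  assumes "strongly_convex \<rho> f" and "0 \<le> \<rho>"
  shows "convex_on UNIV f"
proof -
  have "convex_on UNIV (\<lambda>x::'a. (norm x)\<^sup>2)"
  proof (rule convex_onI)
    fix t :: real and x y :: 'a
    assume "0 < t" "t < 1"
    then have "0 \<le> t * (1 - t) * (norm (x - y))\<^sup>2"
      by simp
    also have "\<dots> = (1 - t) * (norm x)\<^sup>2 + t * (norm y)\<^sup>2
        - (norm ((1 - t) *\<^sub>R x + t *\<^sub>R y))\<^sup>2"
      unfolding power2_norm_eq_inner by (simp add: algebra_simps inner_commute)
    finally show "(norm ((1 - t) *\<^sub>R x + t *\<^sub>R y))\<^sup>2 \<le> (1 - t) * (norm x)\<^sup>2 + t * (norm y)\<^sup>2"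
      by simp
  qed auto
  then have "convex_on UNIV (\<lambda>x. (f x - \<rho> / 2 * (norm x)\<^sup>2) + \<rho> / 2 * (norm x)\<^sup>2)"
    using assms unfolding strongly_convex_def by (intro convex_on_add convex_on_cmul) auto
  then show ?thesis
    by simp
qed

text \<open>Along the segment from \<open>x\<close> to \<open>y\<close>, the difference of the two sides is a
  function of one real variable that vanishes at \<open>0\<close> and, by Cauchy--Schwarz and the
  Lipschitz bound, has nonpositive derivative.\<close>

lemma descent_lemma:
  fixes f :: "'a::real_inner \<Rightarrow> real"
  assumes deriv: "\<And>z. GDERIV f z :> g z" and lip: "l-lipschitz_on UNIV g"
  shows "f y \<le> f x + g x \<bullet> (y - x) + l / 2 * (norm (y - x))\<^sup>2"
proof -
  define d where "d = y - x"
  define h where "h t = f (x + t *\<^sub>R d) - t * (g x \<bullet> d) - l / 2 * t\<^sup>2 * (norm d)\<^sup>2" for t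
  define h' where "h' t = (g (x + t *\<^sub>R d) - g x) \<bullet> d - l * t * (norm d)\<^sup>2" for t
  have "(h has_real_derivative h' t) (at t)" for t
    unfolding h_def h'_def
    by (auto intro!: derivative_eq_intros DERIV_along_line[OF deriv] simp: inner_diff_left)
  moreover have "h' t \<le> 0" if "0 \<le> t" for t
  proof -
    have "(g (x + t *\<^sub>R d) - g x) \<bullet> d \<le> norm (g (x + t *\<^sub>R d) - g x) * norm d"
      by (rule norm_cauchy_schwarz)
    also have "\<dots> \<le> (l * (t * norm d)) * norm d"
      using lipschitz_onD[OF lip, of "x + t *\<^sub>R d" x] that
      by (intro mult_right_mono) (auto simp: dist_norm)
    finally show ?thesis
      by (simp add: h'_def power2_eq_square mult_ac)
  qed
  ultimately have "h 1 \<le> h 0"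
    by (intro DERIV_nonpos_imp_nonincreasing[of 0 1]) auto
  then show ?thesis
    by (simp add: h_def d_def)
qed

text \<open>This is the Baillon--Haddad inequality. The point \<open>x\<close> minimizes the convex function
  \<open>z \<mapsto> f z - g x \<bullet> z\<close>, so its value there is at most the value after one gradient
  step of length \<open>1 / l\<close> from \<open>y\<close>, which the descent lemma bounds. This gives
  \<open>f y \<ge> f x + g x \<bullet> (y - x) + (norm (g y - g x))\<^sup>2 / (2 * l)\<close>, and adding
  the same bound with the points exchanged eliminates the values of \<open>f\<close>.\<close>

lemma convex_gradient_cocoercive:
  fixes f :: "'a::real_inner \<Rightarrow> real"
  assumes convex: "convex_on UNIV f" and deriv: "\<And>z. GDERIV f z :> g z"
    and lip: "l-lipschitz_on UNIV g" and "0 < l"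
  shows "(norm (g x - g y))\<^sup>2 \<le> l * ((g x - g y) \<bullet> (x - y))"
proof -
  have half: "f x + g x \<bullet> (y - x) + (norm (g y - g x))\<^sup>2 / (2 * l) \<le> f y" for x y
  proof -
    define d where "d = g y - g x"
    define z where "z = y - (1 / l) *\<^sub>R d"
    have "f x + g x \<bullet> (z - x) \<le> f z"
      by (rule convex_above_tangent[OF convex deriv])
    also have "f z \<le> f y + g y \<bullet> (z - y) + l / 2 * (norm (z - y))\<^sup>2"
      by (rule descent_lemma[OF deriv lip])
    also have "l / 2 * (norm (z - y))\<^sup>2 = (norm d)\<^sup>2 / (2 * l)"
      using \<open>0 < l\<close> by (simp add: z_def field_simps power2_eq_square)
    also have "g y \<bullet> (z - y) = g x \<bullet> (z - y) - (norm d)\<^sup>2 / l"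
      unfolding z_def power2_norm_eq_inner d_def by (simp add: algebra_simps diff_divide_distrib add_divide_distrib)
    finally show ?thesis
      using \<open>0 < l\<close> by (simp add: d_def inner_diff_right field_simps)
  qed
  have "(norm (g x - g y))\<^sup>2 / l \<le> (g x - g y) \<bullet> (x - y)"
    using half[of x y] half[of y x] by (simp add: norm_minus_commute algebra_simps)
  then show ?thesis
    using \<open>0 < l\<close> by (simp add: field_simps)
qed

section \<open>Spectral bounds, block vectors and the saddle metric\<close>

lemma inner_transpose_matrix:
  fixes A :: "real^'n^'m"
  shows "x \<bullet> (transpose A *v y) = (A *v x) \<bullet> y"
  by (simp add: dot_lmul_matrix[symmetric] inner_commute)

lemma inner_gram_matrix:
  fixes A :: "real^'n^'m"
  shows "y \<bullet> ((A ** transpose A) *v y) = (norm (transpose A *v y))\<^sup>2"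
  by (simp add: matrix_vector_mul_assoc[symmetric] dot_lmul_matrix[symmetric]
      power2_norm_eq_inner)

lemma gram_lower_bound:
  fixes A :: "real^'n^'m"
  assumes "a *\<^sub>R mat 1 \<preceq> A ** transpose A"
  shows "a * (norm y)\<^sup>2 \<le> (norm (transpose A *v y))\<^sup>2"
proof -
  have "0 \<le> y \<bullet> ((A ** transpose A - a *\<^sub>R mat 1) *v y)"
    using assms by (simp add: loewner_le_def pos_semidef_def)
  then show ?thesis
    by (simp add: matrix_vector_mult_diff_rdistrib inner_diff_right inner_gram_matrix
        scaleR_matrix_vector_assoc[symmetric] power2_norm_eq_inner[of y])
qed

lemma gram_upper_bound:
  fixes A :: "real^'n^'m"
  assumes "A ** transpose A \<preceq> a *\<^sub>R mat 1"
  shows "(norm (transpose A *v y))\<^sup>2 \<le> a * (norm y)\<^sup>2"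
proof -
  have "0 \<le> y \<bullet> ((a *\<^sub>R mat 1 - A ** transpose A) *v y)"
    using assms by (simp add: loewner_le_def pos_semidef_def)
  then show ?thesis
    by (simp add: matrix_vector_mult_diff_rdistrib inner_diff_right inner_gram_matrix
        scaleR_matrix_vector_assoc[symmetric] power2_norm_eq_inner[of y])
qed

text \<open>A matrix and its transpose have the same operator norm: \<open>(norm (A *v x))\<^sup>2\<close> is the
  inner product of \<open>x\<close> with \<open>transpose A *v (A *v x)\<close>, so Cauchy--Schwarz transfers a
  bound on the transpose.\<close>

lemma matrix_bound_of_transpose_bound:
  fixes A :: "real^'n^'m"
  assumes bound: "\<And>y. (norm (transpose A *v y))\<^sup>2 \<le> a * (norm y)\<^sup>2"
  shows "(norm (A *v x))\<^sup>2 \<le> a * (norm x)\<^sup>2"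
proof (cases "A *v x = 0")
  case True
  have "0 \<le> a * (norm (axis undefined 1 :: real^'m))\<^sup>2"
    using bound[of "axis undefined 1"] by (rule order_trans[rotated]) simp
  then show ?thesis
    using True by (simp add: norm_axis_1)
next
  case False
  define v where "v = A *v x"
  have "((norm v)\<^sup>2)\<^sup>2 = (x \<bullet> (transpose A *v v))\<^sup>2"
    by (simp only: inner_transpose_matrix v_def power2_norm_eq_inner)
  also have "\<dots> \<le> (norm x)\<^sup>2 * (norm (transpose A *v v))\<^sup>2"
    using Cauchy_Schwarz_ineq[of x "transpose A *v v"] by (simp add: power2_norm_eq_inner)
  also have "\<dots> \<le> (norm x)\<^sup>2 * (a * (norm v)\<^sup>2)"
    by (intro mult_left_mono bound) simp
  finally have "(norm v)\<^sup>2 * (norm v)\<^sup>2 \<le> (a * (norm x)\<^sup>2) * (norm v)\<^sup>2"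
    by (simp add: power2_eq_square mult_ac)
  then have "(norm v)\<^sup>2 \<le> a * (norm x)\<^sup>2"
    by (rule mult_right_le_imp_le) (simp add: False v_def)
  then show ?thesis
    unfolding v_def .
qed

lemma join_vec_parts: "join_vec (left_part z) (right_part z) = z"
  by (auto simp: join_vec_def left_part_def right_part_def vec_eq_iff split: sum.split)

lemma join_vec_diff: "join_vec x y - join_vec x' y' = join_vec (x - x') (y - y')"
  by (auto simp: join_vec_def vec_eq_iff split: sum.split)

lemma left_part_diff: "left_part (z - z') = left_part z - left_part z'"
  by (simp add: left_part_def vec_eq_iff)

lemma right_part_diff: "right_part (z - z') = right_part z - right_part z'"
  by (simp add: right_part_def vec_eq_iff)

lemma join_vec_eq_0_iff: "join_vec x y = 0 \<longleftrightarrow> x = 0 \<and> y = 0"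
  by (auto simp: join_vec_def vec_eq_iff split: sum.split_asm sum.split)

lemma inner_join_vec:
  fixes x x' :: "real^'n" and y y' :: "real^'m"
  shows "join_vec x y \<bullet> join_vec x' y' = x \<bullet> x' + y \<bullet> y'"
  unfolding inner_vec_def join_vec_def
  by (subst UNIV_Plus_UNIV[symmetric], subst sum.Plus) auto

lemma block_matrix_mult_join_vec:
  "block_matrix A B C D *v join_vec x y = join_vec (A *v x + B *v y) (C *v x + D *v y)"
proof -
  have mult: "(M *v v) $ k = M $ k \<bullet> v" for M :: "real^'k^'j" and v k
    by (simp add: matrix_vector_mult_def inner_vec_def)
  show ?thesis
    by (auto simp: vec_eq_iff mult block_matrix_def inner_join_vec)
       (auto simp: join_vec_def mult inner_join_vec[unfolded join_vec_def] split: sum.split)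
qed

lemma continuous_on_join_vec:
  assumes "continuous_on S f" and "continuous_on S g"
  shows "continuous_on S (\<lambda>x. join_vec (f x) (g x))"
  unfolding join_vec_def
proof (rule continuous_on_vec_lambda)
  fix k
  show "continuous_on S (\<lambda>x. case k of Inl i \<Rightarrow> f x $ i | Inr j \<Rightarrow> g x $ j)"
    by (cases k) (auto intro!: continuous_intros assms)
qed

lemma transpose_saddle_metric:
  "transpose (block_matrix (mat 1) (\<alpha> *\<^sub>R transpose A) (\<alpha> *\<^sub>R A) (mat 1))
    = block_matrix (mat 1) (\<alpha> *\<^sub>R transpose A) (\<alpha> *\<^sub>R A) (mat 1)"
  by (auto simp: vec_eq_iff transpose_def block_matrix_def join_vec_def mat_def split: sum.split)

lemma saddle_metric_inner:
  fixes A :: "real^'n^'m"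
  shows "join_vec u v \<bullet>
      (block_matrix (mat 1) (\<alpha> *\<^sub>R transpose A) (\<alpha> *\<^sub>R A) (mat 1) *v join_vec x y)
    = u \<bullet> x + v \<bullet> y + \<alpha> * (u \<bullet> (transpose A *v y)) + \<alpha> * ((A *v x) \<bullet> v)"
  by (simp add: block_matrix_mult_join_vec inner_join_vec inner_add_right
      scaleR_matrix_vector_assoc[symmetric] inner_commute)

text \<open>Completing the square in \<open>x\<close> leaves the Schur complement
  \<open>(norm y)\<^sup>2 - \<alpha>\<^sup>2 * (norm (transpose A *v y))\<^sup>2\<close>, which the hypothesis makes
  positive for nonzero \<open>y\<close>.\<close>

lemma saddle_metric_pos_def:
  fixes A :: "real^'n^'m"
  assumes bound: "\<And>y. y \<noteq> 0 \<Longrightarrow> \<alpha>\<^sup>2 * (norm (transpose A *v y))\<^sup>2 < (norm y)\<^sup>2"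
  shows "pos_def (block_matrix (mat 1) (\<alpha> *\<^sub>R transpose A) (\<alpha> *\<^sub>R A) (mat 1))"
  unfolding pos_def_def
proof (intro conjI allI impI transpose_saddle_metric)
  fix z :: "real^('n + 'm)"
  assume "z \<noteq> 0"
  define x where "x = left_part z"
  define y where "y = right_part z"
  define w where "w = transpose A *v y"
  have z: "z = join_vec x y"
    by (simp add: x_def y_def join_vec_parts)
  have square: "z \<bullet> (block_matrix (mat 1) (\<alpha> *\<^sub>R transpose A) (\<alpha> *\<^sub>R A) (mat 1) *v z)
      = (norm (x + \<alpha> *\<^sub>R w))\<^sup>2 + ((norm y)\<^sup>2 - \<alpha>\<^sup>2 * (norm w)\<^sup>2)"
    unfolding z saddle_metric_inner inner_transpose_matrix[symmetric] w_def[symmetric]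
      power2_norm_eq_inner
    by (simp add: algebra_simps inner_commute power2_eq_square)
  show "0 < z \<bullet> (block_matrix (mat 1) (\<alpha> *\<^sub>R transpose A) (\<alpha> *\<^sub>R A) (mat 1) *v z)"
  proof (cases "y = 0")
    case True
    then have "x \<noteq> 0" "w = 0"
      using \<open>z \<noteq> 0\<close> by (auto simp: z join_vec_eq_0_iff w_def)
    then show ?thesis
      using square True by simp
  next
    case False
    then show ?thesis
      using bound[of y] unfolding square w_def by (simp add: add_nonneg_pos)
  qed
qed

section \<open>The contraction estimate\<close>

text \<open>Both terms in which \<open>w\<close> appears linearly combine to \<open>\<alpha> * (h \<bullet> w)\<close> with
  \<open>h = g - (2 * c) *\<^sub>R x\<close>, and completing the square costs
  \<open>\<alpha> / 2 * (norm h)\<^sup>2\<close>. Since \<open>c\<close> is small against \<open>\<rho>\<close>, subtracting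
  \<open>(2 * c) *\<^sub>R x\<close> does not increase the norm of \<open>g\<close>, so cocoercivity bounds this cost
  by a quarter of \<open>g \<bullet> x\<close>. The other three quarters are enough for the left-hand side:
  two of them pay for \<open>\<rho> / 2\<close> and one for \<open>c\<close>.\<close>

lemma contraction_estimate:
  fixes x w g :: "'a::real_inner" and \<alpha> c \<rho> l :: real
  assumes "0 < \<rho>" and "0 < l" and "0 \<le> \<alpha>" and "0 \<le> c" and "c \<le> \<rho> / 4" and "\<alpha> * l \<le> 1 / 2"
    and strong: "\<rho> * (norm x)\<^sup>2 \<le> g \<bullet> x" and coco: "(norm g)\<^sup>2 \<le> l * (g \<bullet> x)"
  shows "(\<rho> / 2 + c) * (norm x)\<^sup>2 \<le> g \<bullet> x + \<alpha> * (g \<bullet> w) + \<alpha> / 2 * (norm w)\<^sup>2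
    - 2 * c * \<alpha> * (x \<bullet> w)"
proof -
  define h where "h = g - (2 * c) *\<^sub>R x"
  have gx: "0 \<le> g \<bullet> x"
  proof -
    have "0 \<le> \<rho> * (norm x)\<^sup>2"
      using \<open>0 < \<rho>\<close> by simp
    then show ?thesis
      using strong by linarith
  qed
  have "\<alpha> * (norm g)\<^sup>2 \<le> (\<alpha> * l) * (g \<bullet> x)"
    using mult_left_mono[OF coco \<open>0 \<le> \<alpha>\<close>] by (simp add: mult_ac)
  also have "\<dots> \<le> 1 / 2 * (g \<bullet> x)"
    using \<open>\<alpha> * l \<le> 1 / 2\<close> gx by (rule mult_right_mono)
  finally have g2: "\<alpha> * (norm g)\<^sup>2 \<le> 1 / 2 * (g \<bullet> x)" .
  have "c * (norm x)\<^sup>2 \<le> \<rho> / 4 * (norm x)\<^sup>2"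
    using \<open>c \<le> \<rho> / 4\<close> by (rule mult_right_mono) simp
  then have cx: "c * (norm x)\<^sup>2 \<le> 1 / 4 * (g \<bullet> x)"
    using strong by simp
  have "(norm h)\<^sup>2 = (norm g)\<^sup>2 - 4 * c * (g \<bullet> x - c * (norm x)\<^sup>2)"
    unfolding h_def power2_norm_eq_inner by (simp add: algebra_simps inner_commute)
  also have "\<dots> \<le> (norm g)\<^sup>2"
    using cx gx \<open>0 \<le> c\<close> by simp
  finally have "\<alpha> * (norm h)\<^sup>2 \<le> \<alpha> * (norm g)\<^sup>2"
    using \<open>0 \<le> \<alpha>\<close> by (rule mult_left_mono)
  then have h2: "\<alpha> * (norm h)\<^sup>2 \<le> 1 / 2 * (g \<bullet> x)"
    using g2 by (rule order_trans)
  have "0 \<le> \<alpha> / 2 * (norm (h + w))\<^sup>2"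
    using \<open>0 \<le> \<alpha>\<close> by simp
  also have "\<dots> = \<alpha> / 2 * (norm h)\<^sup>2 + \<alpha> * (h \<bullet> w) + \<alpha> / 2 * (norm w)\<^sup>2"
    unfolding power2_norm_eq_inner by (simp add: algebra_simps inner_commute)
  also have "\<alpha> * (h \<bullet> w) = \<alpha> * (g \<bullet> w) - 2 * c * \<alpha> * (x \<bullet> w)"
    by (simp add: h_def algebra_simps)
  finally show ?thesis
    using h2 cx strong by (simp add: algebra_simps)
qed

theorem theorem9:
  fixes f :: "real^'n \<Rightarrow> real"
    and A :: "real^'n^'m"
    and b :: "real^'m"
    and \<rho> l a_min a_max \<alpha> c :: real
    and P :: "real^('n + 'm)^('n + 'm)"
  assumes "continuously_differentiable f"
    and "\<rho> > 0" and "strongly_convex \<rho> f"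
    and "strongly_smooth l f"
    and "a_min > 0" and "a_max > 0"
    and "a_min *\<^sub>R mat 1 \<preceq> A ** transpose A"
    and "A ** transpose A \<preceq> a_max *\<^sub>R mat 1"
    and "\<alpha> = 1 / 2 * min (1 / l) (\<rho> / a_max)"
    and "c = 1 / 2 * \<alpha> * a_min"
    and "P = block_matrix (mat 1) (\<alpha> *\<^sub>R transpose A) (\<alpha> *\<^sub>R A) (mat 1)"
  shows "pos_def P \<and> c > 0 \<and>
         c = 1 / 4 * min (a_min / l) (a_min / a_max * \<rho>) \<and>
         strongly_inf_contracting P c (primal_dual_dynamics f A b)"
proof -
  have deriv: "GDERIV f z :> gradient f z" for z
    using assms(1) by (intro GDERIV_gradient) (simp add: continuously_differentiable_def)
  have lip: "l-lipschitz_on UNIV (gradient f)"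
    using assms(4) by (simp add: strongly_smooth_def)
  note strong = strongly_convex_gradient_monotone[OF assms(3) deriv]
  note lower = gram_lower_bound[OF assms(7)]
  note upper = gram_upper_bound[OF assms(8)]

  \<comment> \<open>Both index types are nonempty, so a unit vector in each space lets the lower and upper
    bounds be compared.\<close>
  have "\<rho> \<le> l"
  proof -
    define e :: "real^'n" where "e = axis undefined 1"
    have "\<rho> * (norm (e - 0))\<^sup>2 \<le> (gradient f e - gradient f 0) \<bullet> (e - 0)"
      by (rule strong)
    also have "\<dots> \<le> norm (gradient f e - gradient f 0) * norm (e - 0)"
      by (rule norm_cauchy_schwarz)
    also have "\<dots> \<le> (l * norm (e - 0)) * norm (e - 0)"
      using lipschitz_onD[OF lip, of e 0] by (intro mult_right_mono) (auto simp: dist_norm)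
    finally show ?thesis
      by (simp add: e_def norm_axis_1)
  qed
  then have "0 < l"
    using \<open>\<rho> > 0\<close> by simp
  have "a_min \<le> a_max"
    using order_trans[OF lower upper, of "axis undefined 1"] by (simp add: norm_axis_1)
  have "0 < \<alpha>"
    using \<open>0 < l\<close> \<open>\<rho> > 0\<close> \<open>a_max > 0\<close> by (simp add: assms(9))
  have "\<alpha> * l \<le> 1 / 2" and \<alpha>_a_max: "\<alpha> * a_max \<le> \<rho> / 2"
  proof -
    have "\<alpha> \<le> 1 / 2 * (1 / l)" "\<alpha> \<le> 1 / 2 * (\<rho> / a_max)"
      unfolding assms(9) by auto
    then show "\<alpha> * l \<le> 1 / 2" "\<alpha> * a_max \<le> \<rho> / 2"
      using \<open>0 < l\<close> \<open>a_max > 0\<close> by (simp_all add: field_simps)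
  qed
  have "0 < c"
    using \<open>0 < \<alpha>\<close> \<open>a_min > 0\<close> by (simp add: assms(10))
  have "c \<le> \<rho> / 4"
  proof -
    have "\<alpha> * a_min \<le> \<alpha> * a_max"
      using \<open>a_min \<le> a_max\<close> \<open>0 < \<alpha>\<close> by simp
    then show ?thesis
      using \<alpha>_a_max unfolding assms(10) by linarith
  qed
  have c_eq: "c = 1 / 4 * min (a_min / l) (a_min / a_max * \<rho>)"
  proof -
    have "min (1 / l) (\<rho> / a_max) * a_min = min (a_min / l) (a_min / a_max * \<rho>)"
      using \<open>a_min > 0\<close> by (subst min_mult_distrib_right) (simp add: mult.commute)
    then show ?thesis
      unfolding assms(10) assms(9) by simp
  qed

  have "pos_def P"
    unfolding assms(11)
  proof (rule saddle_metric_pos_def)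
    fix y :: "real^'m"
    assume "y \<noteq> 0"
    have "\<alpha> * \<rho> \<le> \<alpha> * l"
      using \<open>\<rho> \<le> l\<close> \<open>0 < \<alpha>\<close> by simp
    then have "\<alpha> * (\<alpha> * a_max) < 1"
      using mult_left_mono[OF \<alpha>_a_max, of \<alpha>] \<open>\<alpha> * l \<le> 1 / 2\<close> \<open>0 < \<alpha>\<close> by linarith
    then have "\<alpha>\<^sup>2 * (a_max * (norm y)\<^sup>2) < (norm y)\<^sup>2"
      using \<open>y \<noteq> 0\<close> by (simp add: power2_eq_square mult.assoc[symmetric])
    moreover have "\<alpha>\<^sup>2 * (norm (transpose A *v y))\<^sup>2 \<le> \<alpha>\<^sup>2 * (a_max * (norm y)\<^sup>2)"
      by (intro mult_left_mono upper) simp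
    ultimately show "\<alpha>\<^sup>2 * (norm (transpose A *v y))\<^sup>2 < (norm y)\<^sup>2"
      by simp
  qed

  have "convex_on UNIV f"
    using assms(2,3) by (intro strongly_convex_imp_convex) auto
  note coco = convex_gradient_cocoercive[OF this deriv lip \<open>0 < l\<close>]

  let ?G = "primal_dual_dynamics f A b"
  have parts: "continuous_on UNIV left_part" "continuous_on UNIV right_part"
    unfolding left_part_def right_part_def by (auto intro!: continuous_intros)
  have "continuous_on UNIV (\<lambda>z. gradient f (left_part z))"
    using continuous_on_compose2[OF _ parts(1), of UNIV "gradient f"] assms(1)
    by (simp add: continuously_differentiable_def)
  then have "continuous_on UNIV ?G"
    unfolding primal_dual_dynamics_def
    by (intro continuous_on_join_vec continuous_intros parts
        matrix_vector_mult_linear_continuous_on[THEN continuous_on_compose2]) auto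
  moreover have "(?G z1 - ?G z2) \<bullet> (P *v (z1 - z2)) \<le> - c * (weighted_norm P (z1 - z2))\<^sup>2"
    for z1 z2
  proof -
    define x where "x = left_part z1 - left_part z2"
    define y where "y = right_part z1 - right_part z2"
    define g where "g = gradient f (left_part z1) - gradient f (left_part z2)"
    define w where "w = transpose A *v y"
    have z: "z1 - z2 = join_vec x y"
      by (metis join_vec_parts left_part_diff right_part_diff x_def y_def)
    have G: "?G z1 - ?G z2 = join_vec (- g - w) (A *v x)"
      by (simp add: primal_dual_dynamics_def join_vec_diff g_def w_def x_def y_def
          matrix_vector_mult_diff_distrib algebra_simps)
    \<comment> \<open>Nonnegativity lets the square cancel the square root in the weighted norm.\<close>
    have "0 \<le> (z1 - z2) \<bullet> (P *v (z1 - z2))"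
      using \<open>pos_def P\<close> unfolding pos_def_def by (cases "z1 = z2") (auto intro: less_imp_le)
    then have "(weighted_norm P (z1 - z2))\<^sup>2 = (z1 - z2) \<bullet> (P *v (z1 - z2))"
      by (simp add: weighted_norm_def)
    also have "\<dots> = (norm x)\<^sup>2 + (norm y)\<^sup>2 + 2 * \<alpha> * (x \<bullet> w)"
      unfolding z assms(11) saddle_metric_inner inner_transpose_matrix[symmetric]
        w_def[symmetric] by (simp add: power2_norm_eq_inner)
    finally have weighted:
      "(weighted_norm P (z1 - z2))\<^sup>2 = (norm x)\<^sup>2 + (norm y)\<^sup>2 + 2 * \<alpha> * (x \<bullet> w)" .
    \<comment> \<open>This is the cancellation of the skew coupling.\<close>
    have "(A *v x) \<bullet> y = w \<bullet> x"
      by (metis inner_commute inner_transpose_matrix w_def)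
    then have "(?G z1 - ?G z2) \<bullet> (P *v (z1 - z2))
        = - (g \<bullet> x) - \<alpha> * (g \<bullet> w) - \<alpha> * (norm w)\<^sup>2 + \<alpha> * (norm (A *v x))\<^sup>2"
      unfolding z G assms(11) saddle_metric_inner w_def[symmetric]
      by (simp add: power2_norm_eq_inner algebra_simps)
    moreover have "(\<rho> / 2 + c) * (norm x)\<^sup>2
        \<le> g \<bullet> x + \<alpha> * (g \<bullet> w) + \<alpha> / 2 * (norm w)\<^sup>2 - 2 * c * \<alpha> * (x \<bullet> w)"
      using \<open>0 < \<rho>\<close> \<open>0 < l\<close> \<open>0 < \<alpha>\<close> \<open>0 < c\<close> \<open>c \<le> \<rho> / 4\<close> \<open>\<alpha> * l \<le> 1 / 2\<close>
        strong[of "left_part z1" "left_part z2"] coco[of "left_part z1" "left_part z2"]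
      by (intro contraction_estimate) (auto simp: x_def g_def)
    moreover have "\<alpha> * (norm (A *v x))\<^sup>2 \<le> \<rho> / 2 * (norm x)\<^sup>2"
    proof -
      have "\<alpha> * (norm (A *v x))\<^sup>2 \<le> \<alpha> * (a_max * (norm x)\<^sup>2)"
        using matrix_bound_of_transpose_bound[OF upper] \<open>0 < \<alpha>\<close>
        by (rule mult_left_mono[OF _ less_imp_le])
      also have "\<dots> \<le> \<rho> / 2 * (norm x)\<^sup>2"
        unfolding mult.assoc[symmetric] using \<alpha>_a_max by (rule mult_right_mono) simp
      finally show ?thesis .
    qed
    moreover have "c * (norm y)\<^sup>2 \<le> \<alpha> / 2 * (norm w)\<^sup>2"
      using mult_left_mono[OF lower[of y], of "\<alpha> / 2"] \<open>0 < \<alpha>\<close>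
      by (simp add: assms(10) w_def mult_ac)
    ultimately show ?thesis
      unfolding weighted by (simp add: algebra_simps)
  qed
  ultimately have "strongly_inf_contracting P c ?G"
    using \<open>pos_def P\<close> \<open>0 < c\<close> by (simp add: strongly_inf_contracting_def)
  then show ?thesis
    using \<open>pos_def P\<close> \<open>0 < c\<close> c_eq by blast
qed

end
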